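(* Let $m\ge3$ be an odd integer and let $n\ge 3$ be an integer that is not a multiple of $m$. Then $(n-1,1)\notin\mathrm{HWP}(C_m[n];m,n)$; that is, the edges of $C_m[n]$ cannot be partitioned into $n-1$ $C_m$-factors and one $C_n$-factor.
   Context: $C_m[n]$ is the lexicographic product of the $m$-cycle with the empty graph on $n$ vertices: vertex set $\mathbb{Z}_m\times\mathbb{Z}_n$, with $(x,i)$ adjacent to $(y,j)$ iff $y=x\pm1$ in $\mathbb{Z}_m$ (any $i,j$). For $k\ge3$ a $C_k$-factor is a spanning subgraph all of whose components are $k$-cycles. $\mathrm{HWP}(G;m,n)$ is the set of pairs $(\alpha,\beta)$ such that the edges of $G$ can be partitioned into $\alpha$ $C_m$-factors and $\beta$ $C_n$-factors. *)

theory Defs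
  imports "HOL-Library.Disjoint_Sets" "HOL-Number_Theory.Cong"
begin

text \<open>Undirected graphs, an edge being the set of its two ends. That edges are two-element
  sets of vertices is not part of the type; it holds for
  \<open>C\<^sub>m[n]\<close> below when \<open>m \<ge> 2\<close>, and then for its factors.\<close>

record 'v ugraph =
  verts :: "'v set"
  edges :: "'v set set"

definition spanning_subgraph :: "'v ugraph \<Rightarrow> 'v ugraph \<Rightarrow> bool" where
  "spanning_subgraph H G \<longleftrightarrow> verts H = verts G \<and> edges H \<subseteq> edges G"

definition induced :: "'v ugraph \<Rightarrow> 'v set \<Rightarrow> 'v ugraph" where
  "induced G C = \<lparr>verts = C, edges = {e \<in> edges G. e \<subseteq> C}\<rparr>"

definition connected_rel :: "'v ugraph \<Rightarrow> ('v \<times> 'v) set" where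
  "connected_rel G = {(u, v). {u, v} \<in> edges G}\<^sup>* \<inter> verts G \<times> verts G"

definition components :: "'v ugraph \<Rightarrow> 'v ugraph set" where
  "components G = induced G ` (verts G // connected_rel G)"

definition is_cycle :: "nat \<Rightarrow> 'v ugraph \<Rightarrow> bool" where
  "is_cycle k G \<longleftrightarrow> k \<ge> 3 \<and> (\<exists>vs. distinct vs \<and> length vs = k \<and> verts G = set vs \<and>
     edges G = {{vs ! i, vs ! (Suc i mod k)} | i. i < k})"

definition cycle_factor :: "nat \<Rightarrow> 'v ugraph \<Rightarrow> 'v ugraph \<Rightarrow> bool" where
  "cycle_factor k G H \<longleftrightarrow> spanning_subgraph H G \<and> (\<forall>K \<in> components H. is_cycle k K)"

text \<open>The factors are listed, and \<^term>\<open>distinct\<close> makes the parts of the partition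
  pairwise different, so that \<open>\<alpha>\<close> and \<open>\<beta>\<close> count them also when \<open>m = n\<close>.\<close>

definition HWP :: "'v ugraph \<Rightarrow> nat \<Rightarrow> nat \<Rightarrow> (nat \<times> nat) set" where
  "HWP G m n = {(\<alpha>, \<beta>). \<exists>As Bs. length As = \<alpha> \<and> length Bs = \<beta> \<and>
     (\<forall>H \<in> set As. cycle_factor m G H) \<and> (\<forall>H \<in> set Bs. cycle_factor n G H) \<and>
     distinct (map edges (As @ Bs)) \<and>
     partition_on (edges G) (set (map edges (As @ Bs)))}"

text \<open>The graph \<open>C\<^sub>m[n]\<close>, with \<open>{0..<m}\<close> and \<open>{0..<n}\<close> as representatives of the
  integers modulo \<open>m\<close> and \<open>n\<close>.\<close>

definition cycle_blowup :: "nat \<Rightarrow> nat \<Rightarrow> (int \<times> int) ugraph" where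
  "cycle_blowup m n =
    (let V = {0..<int m} \<times> {0..<int n} in
     \<lparr>verts = V,
      edges = {{(x, i), (y, j)} | x i y j. (x, i) \<in> V \<and> (y, j) \<in> V \<and>
                 ([y = x + 1] (mod int m) \<or> [y = x - 1] (mod int m))}\<rparr>)"

end

theory Submission
  imports Defs
begin

text \<open>Since \<open>m\<close> is odd, a closed walk of length \<open>m\<close> in the \<open>m\<close>-cycle cannot turn back, so every
  \<open>m\<close>-cycle of \<open>C\<^sub>m[n]\<close> meets each column once and a \<open>C\<^sub>m\<close>-factor restricts to a perfect matching
  between any two consecutive columns. Removing \<open>n - 1\<close> such matchings from the complete
  bipartite graph between two consecutive columns leaves a perfect matching, so each component of
  the remaining factor has equally many vertices in every column. Its number of vertices is
  therefore a multiple of \<open>m\<close>.\<close>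

section \<open>Closed walks of odd length \<open>m\<close> around the \<open>m\<close>-cycle\<close>

text \<open>Each \<open>d i + 1\<close> is 0 or 2, so the sum of the signs has the parity of
  \<open>m\<close> and is nonzero. A nonzero multiple of \<open>m\<close> of absolute value at most
  \<open>m\<close> is \<open>m\<close> or \<open>-m\<close>, which leaves no room for two different
  signs.\<close>

lemma signs_constant:
  fixes d :: "nat \<Rightarrow> int"
  assumes "odd m" and d: "\<And>i. i < m \<Longrightarrow> d i = 1 \<or> d i = -1"
    and dvd: "int m dvd (\<Sum>i<m. d i)"
  shows "\<exists>s\<in>{1, -1}. \<forall>i<m. d i = s"
proof -
  let ?S = "\<Sum>i<m. d i"
  have "even (\<Sum>i<m. d i + 1)"
    using d by (intro dvd_sum) fastforce
  then have "odd ?S"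
    using \<open>odd m\<close> by (simp add: sum.distrib)
  then have "?S \<noteq> 0" by (metis even_zero)
  with dvd have ge: "int m \<le> \<bar>?S\<bar>"
    using dvd_imp_le_int[of ?S "int m"] by simp
  have le: "\<bar>?S\<bar> \<le> int m"
  proof -
    have "\<bar>?S\<bar> \<le> (\<Sum>i<m. \<bar>d i\<bar>)" by (rule sum_abs)
    also have "\<dots> \<le> (\<Sum>i<m. 1)" using d by (intro sum_mono) fastforce
    finally show ?thesis by simp
  qed
  obtain s :: int where s: "s \<in> {1, -1}" "?S = s * int m"
    using ge le that[of 1] that[of "-1"] by (cases "?S \<ge> 0") auto
  \<comment> \<open>Since \<open>s * s = 1\<close>, the terms \<open>1 - s * d i\<close> sum to 0;
    they are nonnegative, so each of them vanishes.\<close>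
  have "(\<Sum>i<m. 1 - s * d i) = int m - s * ?S"
    by (simp add: sum_subtractf sum_distrib_left)
  also have "\<dots> = 0" using s by auto
  finally have z: "(\<Sum>i<m. 1 - s * d i) = 0" .
  have "\<forall>i\<in>{..<m}. 1 - s * d i = 0"
  proof (subst sum_nonneg_eq_0_iff[symmetric])
    show "0 \<le> 1 - s * d i" if "i \<in> {..<m}" for i
      using d[of i] s(1) that by auto
  qed (use z in auto)
  then have "\<forall>i<m. d i = s" using s(1) by auto
  then show ?thesis using s(1) by auto
qed

text \<open>Around a closed walk the column differences telescope to 0, so the chosen signs sum to a
  multiple of \<open>m\<close> and \<open>signs_constant\<close> applies.\<close>

lemma closed_walk_winds:
  fixes c :: "nat \<Rightarrow> int"
  assumes "odd m"
    and c: "\<And>i. i < m \<Longrightarrow> [c (Suc i mod m) = c i + 1] (mod int m) \<or>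
                             [c (Suc i mod m) = c i - 1] (mod int m)"
  shows "\<exists>s\<in>{1, -1}. \<forall>i<m. [c (Suc i mod m) = c i + s] (mod int m)"
proof -
  have "\<exists>e. (e = 1 \<or> e = -1) \<and> [c (Suc i mod m) = c i + e] (mod int m)" if "i < m" for i
    using c[OF that] by (metis diff_conv_add_uminus)
  then obtain d :: "nat \<Rightarrow> int" where d: "\<And>i. i < m \<Longrightarrow> d i = 1 \<or> d i = -1"
    and cd: "\<And>i. i < m \<Longrightarrow> [c (Suc i mod m) = c i + d i] (mod int m)"
    by metis
  obtain k where k: "m = Suc k" using \<open>odd m\<close> by (cases m) auto
  \<comment> \<open>A cyclic shift permutes the summands: the wrapped term \<open>c 0\<close> is
    last in one sum and first in the other.\<close>
  have "(\<Sum>i<m. c (Suc i mod m)) = (\<Sum>i<k. c (Suc i)) + c 0"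
    unfolding k by simp
  also have "\<dots> = (\<Sum>i<m. c i)"
    unfolding k sum.lessThan_Suc_shift by simp
  finally have "(\<Sum>i<m. c (Suc i mod m)) = (\<Sum>i<m. c i)" .
  moreover have "[(\<Sum>i<m. c (Suc i mod m)) = (\<Sum>i<m. c i + d i)] (mod int m)"
    by (intro cong_sum) (use cd in auto)
  ultimately have "int m dvd (\<Sum>i<m. d i)"
    by (simp add: sum.distrib cong_iff_dvd_diff)
  from signs_constant[OF \<open>odd m\<close> d this] show ?thesis using cd by auto
qed

section \<open>Edges of the blow-up and components of its factors\<close>

lemma verts_blowup: "verts (cycle_blowup m n) = {0..<int m} \<times> {0..<int n}"
  by (simp add: cycle_blowup_def Let_def)

text \<open>The ends of an edge come in no order, but the condition on their columns is symmetric,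
  so it can be read off from either ordering.\<close>

lemma edge_blowup_iff:
  "{v, w} \<in> edges (cycle_blowup m n) \<longleftrightarrow>
     v \<in> verts (cycle_blowup m n) \<and> w \<in> verts (cycle_blowup m n) \<and>
     ([fst w = fst v + 1] (mod int m) \<or> [fst w = fst v - 1] (mod int m))"
proof -
  have "[a = b + 1] (mod int m) \<longleftrightarrow> [b = a - 1] (mod int m)" for a b
    using dvd_minus_iff[of "int m" "a - (b + 1)"] by (simp add: cong_iff_dvd_diff algebra_simps)
  then show ?thesis
    unfolding cycle_blowup_def Let_def by (cases v; cases w) (auto simp: doubleton_eq_iff)
qed

definition component_at :: "'v ugraph \<Rightarrow> 'v \<Rightarrow> 'v set" where
  "component_at H v = connected_rel H `` {v}"

lemma component_at:
  assumes "v \<in> verts H"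
  shows "v \<in> component_at H v" and "component_at H v \<subseteq> verts H"
    and "induced H (component_at H v) \<in> components H"
  using assms by (auto simp: component_at_def connected_rel_def components_def quotient_def)

text \<open>That \<open>w\<close> is a vertex has to be assumed, because the type of graphs does not
  force the ends of edges to be vertices.\<close>

lemma component_at_step:
  assumes "u \<in> component_at H v" and "{u, w} \<in> edges H" and "w \<in> verts H"
  shows "w \<in> component_at H v"
  using assms by (auto simp: component_at_def connected_rel_def intro: rtrancl_into_rtrancl)

lemma cycle_factor_component:
  assumes "cycle_factor k G H" and "v \<in> verts G"
  obtains vs where "distinct vs" and "length vs = k"
    and "component_at H v = set vs"
    and "{e \<in> edges H. e \<subseteq> set vs} = {{vs ! i, vs ! (Suc i mod k)} | i. i < k}"
proof -
  have "v \<in> verts H" using assms by (simp add: cycle_factor_def spanning_subgraph_def)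
  then have "is_cycle k (induced H (component_at H v))"
    using assms(1) component_at(3)[of v H] by (auto simp: cycle_factor_def)
  then show ?thesis
    using that by (fastforce simp: is_cycle_def induced_def)
qed

section \<open>Factors into \<open>m\<close>-cycles are matchings between consecutive
  columns\<close>

text \<open>Position \<open>i\<close> lies in column \<open>c 0 + s * i\<close> modulo
  \<open>m\<close>; cancelling \<open>c 0\<close> and the sign \<open>s\<close> leaves
  \<open>a\<close> and \<open>b\<close> congruent.\<close>

lemma m_cycle_meets_column_once:
  assumes "\<And>i. i < m \<Longrightarrow> [c (Suc i mod m) = c i + s] (mod int m)" and "s \<in> {1, -1}"
    and "a < m" and "b < m" and "[c a = c b] (mod int m)"
  shows "a = b"
proof -
  have lin: "[c i = c 0 + s * int i] (mod int m)" if "i < m" for i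
    using that
  proof (induction i)
    case (Suc i)
    then have "[c (Suc i) = c i + s] (mod int m)" using assms(1)[of i] by simp
    moreover have "[c i + s = c 0 + s * int i + s] (mod int m)"
      using Suc by (intro cong_add) auto
    ultimately show ?case by (simp add: algebra_simps) (metis cong_trans)
  qed auto
  have "[c 0 + s * int a = c 0 + s * int b] (mod int m)"
    using lin[OF assms(3)] lin[OF assms(4)] assms(5) by (metis cong_sym cong_trans)
  then have "[s * int a = s * int b] (mod int m)"
    by (simp add: cong_add_lcancel)
  then have "[int a = int b] (mod int m)"
    using assms(2) by (auto simp: cong_minus_minus_iff)
  then show ?thesis
    using assms(3,4) by (simp add: cong_int_iff cong_less_modulus_unique_nat)
qed

text \<open>The argument is an edge set and not a graph, so that it can range over the parts of a
  partition of the edges.\<close>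

definition nbrs_in_column :: "nat \<Rightarrow> (int \<times> int) set set \<Rightarrow> int \<times> int \<Rightarrow> int \<Rightarrow> (int \<times> int) set"
  where "nbrs_in_column n E v y = {w \<in> {y} \<times> {0..<int n}. {v, w} \<in> E}"

text \<open>The \<open>m\<close>-cycle through \<open>v\<close> keeps its direction, so one of the
  two cycle neighbours of \<open>v\<close> lies in column \<open>y\<close>. Every neighbour of
  \<open>v\<close> is on the same cycle, which meets that column only once.\<close>

lemma m_factor_column_degree:
  assumes "odd m" and H: "cycle_factor m (cycle_blowup m n) H"
    and v: "v \<in> verts (cycle_blowup m n)" and y: "y \<in> {0..<int m}"
    and e: "e \<in> {1, -1}" "[y = fst v + e] (mod int m)"
  shows "card (nbrs_in_column n (edges H) v y) = 1"
proof -
  let ?G = "cycle_blowup m n"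
  have V: "verts H = verts ?G" and E: "edges H \<subseteq> edges ?G"
    using H by (auto simp: cycle_factor_def spanning_subgraph_def)
  obtain vs where vs: "distinct vs" "length vs = m" "component_at H v = set vs"
    and Evs: "{e \<in> edges H. e \<subseteq> set vs} = {{vs ! i, vs ! (Suc i mod m)} | i. i < m}"
    using cycle_factor_component[OF H v] .
  have vsV: "set vs \<subseteq> verts ?G" and "v \<in> set vs"
    using component_at[of v H] v V vs(3) by auto
  then obtain j where j: "j < m" "v = vs ! j" using vs(2) by (auto simp: in_set_conv_nth)
  have step: "{vs ! i, vs ! (Suc i mod m)} \<in> edges H" if "i < m" for i
    using Evs that by blast
  let ?c = "\<lambda>i. fst (vs ! i)"
  obtain s where s: "s \<in> {1, -1}"
    and wind: "\<And>i. i < m \<Longrightarrow> [?c (Suc i mod m) = ?c i + s] (mod int m)"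
    using closed_walk_winds[OF \<open>odd m\<close>, of ?c] step E edge_blowup_iff by blast
  \<comment> \<open>The neighbour is the successor of \<open>v\<close> if the cycle runs in
    direction \<open>e\<close>, and the predecessor otherwise.\<close>
  have "\<exists>i<m. {v, vs ! i} \<in> edges H \<and> [?c i = fst v + e] (mod int m)"
  proof (cases "e = s")
    case True
    then show ?thesis
      using step[OF j(1)] wind[OF j(1)] j by (intro exI[of _ "Suc j mod m"]) auto
  next
    case False
    \<comment> \<open>The cyclic predecessor of \<open>j\<close>; the case \<open>j = 0\<close> is
      separate because subtraction on \<open>nat\<close> truncates.\<close>
    define i where "i = (if j = 0 then m - 1 else j - 1)"
    have i: "i < m" "Suc i mod m = j" using j(1) by (auto simp: i_def)
    have "[?c j = ?c i + s] (mod int m)" using wind[OF i(1)] i(2) by simp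
    then have "[?c j - s = ?c i + s - s] (mod int m)" by (intro cong_diff) auto
    moreover have "s = - e" using False s e(1) by auto
    ultimately have "[?c i = fst v + e] (mod int m)" using j(2) by (simp add: cong_sym)
    then show ?thesis using step[OF i(1)] i j(2) by (auto simp: insert_commute)
  qed
  then obtain i where i: "i < m" "{v, vs ! i} \<in> edges H" "[?c i = fst v + e] (mod int m)"
    by blast
  have iV: "vs ! i \<in> {0..<int m} \<times> {0..<int n}"
    using vsV i(1) vs(2) by (metis nth_mem subsetD verts_blowup)
  have "[?c i = y] (mod int m)" using i(3) e(2) by (metis cong_sym cong_trans)
  then have ciy: "?c i = y"
    using iV y cong_less_imp_eq_int[of "?c i" "int m" y] by (simp add: mem_Times_iff)
  have "nbrs_in_column n (edges H) v y = {vs ! i}"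
  proof (intro equalityI subsetI)
    fix w assume "w \<in> nbrs_in_column n (edges H) v y"
    then have w: "fst w = y" "{v, w} \<in> edges H" by (auto simp: nbrs_in_column_def)
    then have "w \<in> verts H" using E V edge_blowup_iff by blast
    then have "w \<in> set vs" using component_at_step[of v H v w] w vs(3) \<open>v \<in> set vs\<close> by auto
    then obtain k where k: "k < m" "w = vs ! k" using vs(2) by (auto simp: in_set_conv_nth)
    have "k = i"
      using m_cycle_meets_column_once[of m ?c s k i] wind s k i(1) ciy w(1) by auto
    then show "w \<in> {vs ! i}" using k by simp
  next
    fix w assume "w \<in> {vs ! i}"
    then show "w \<in> nbrs_in_column n (edges H) v y"
      using i(2) iV ciy by (cases "vs ! i") (auto simp: nbrs_in_column_def)
  qed
  then show ?thesis by simp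
qed

section \<open>The factor left over and the size of its components\<close>

text \<open>In the blow-up \<open>v\<close> is joined to all \<open>n\<close> vertices of column
  \<open>y\<close>, and each of these edges lies in exactly one part.\<close>

lemma sum_column_degrees:
  assumes "partition_on (edges (cycle_blowup m n)) P" and "finite P"
    and v: "v \<in> verts (cycle_blowup m n)" and y: "y \<in> {0..<int m}"
    and e: "e \<in> {1, -1}" "[y = fst v + e] (mod int m)"
  shows "(\<Sum>E\<in>P. card (nbrs_in_column n E v y)) = n"
proof -
  let ?W = "{y} \<times> {0..<int n}"
  have "{v, w} \<in> edges (cycle_blowup m n)" if "w \<in> ?W" for w
    unfolding edge_blowup_iff using that v y e by (auto simp: verts_blowup)
  then have "?W = (\<Union>E\<in>P. nbrs_in_column n E v y)"
    using partition_onD1[OF assms(1)] by (fastforce simp: nbrs_in_column_def)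
  then have "card ?W = card (\<Union>E\<in>P. nbrs_in_column n E v y)" by simp
  also have "\<dots> = (\<Sum>E\<in>P. card (nbrs_in_column n E v y))"
  proof (rule card_UN_disjoint)
    show "\<forall>E\<in>P. finite (nbrs_in_column n E v y)"
      by (auto simp: nbrs_in_column_def intro: finite_subset[of _ ?W])
    show "\<forall>E\<in>P. \<forall>F\<in>P. E \<noteq> F \<longrightarrow> nbrs_in_column n E v y \<inter> nbrs_in_column n F v y = {}"
      using partition_onD2[OF assms(1)] by (fastforce simp: nbrs_in_column_def disjoint_def)
  qed (fact assms(2))
  finally show ?thesis by (simp add: card_cartesian_product)
qed

text \<open>Passing to the unique neighbour in an adjacent column stays inside the component and is
  injective, so all \<open>m\<close> columns contain equally many of its vertices.\<close>

lemma dvd_card_component: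
  assumes H: "spanning_subgraph H (cycle_blowup m n)"
    and deg: "\<And>v y e. v \<in> verts H \<Longrightarrow> y \<in> {0..<int m} \<Longrightarrow> e \<in> {1, -1} \<Longrightarrow>
      [y = fst v + e] (mod int m) \<Longrightarrow> card (nbrs_in_column n (edges H) v y) = 1"
    and v: "v \<in> verts H"
  shows "m dvd card (component_at H v)"
proof -
  have V: "verts H = {0..<int m} \<times> {0..<int n}"
    using H by (simp add: spanning_subgraph_def verts_blowup)
  define K where "K = component_at H v"
  have KV: "K \<subseteq> {0..<int m} \<times> {0..<int n}"
    using component_at(2)[OF v] V by (simp add: K_def)
  define C where "C x = {u \<in> K. fst u = x}" for x
  have finC: "finite (C x)" for x
    using KV by (auto simp: C_def intro: finite_subset[of _ "{0..<int m} \<times> {0..<int n}"])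
  \<comment> \<open>With \<open>e\<close> of either sign, so that the inequality can be used in both
    directions between two adjacent columns.\<close>
  have le: "card (C x) \<le> card (C y)"
    if x: "x \<in> {0..<int m}" and y: "y \<in> {0..<int m}" and e: "e \<in> {1, -1}"
      and xy: "[y = x + e] (mod int m)" for x y e
  proof -
    have yx: "[x = y + - e] (mod int m)"
    proof -
      have "[y + - e = x + e + - e] (mod int m)" using xy by (intro cong_add) auto
      then show ?thesis by (simp add: cong_sym)
    qed
    have "\<exists>w. nbrs_in_column n (edges H) u y = {w}" if "u \<in> C x" for u
      using deg[of u y e] that KV V y e xy by (auto simp: C_def card_1_singleton_iff)
    then obtain f where f: "\<And>u. u \<in> C x \<Longrightarrow> nbrs_in_column n (edges H) u y = {f u}"
      by metis
    then have f': "f u \<in> {y} \<times> {0..<int n}" "{u, f u} \<in> edges H" if "u \<in> C x" for u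
      using f[OF that] by (auto simp: nbrs_in_column_def)
    have "f ` C x \<subseteq> C y"
    proof
      fix w assume "w \<in> f ` C x"
      then obtain u where u: "u \<in> C x" "w = f u" by auto
      then have "w \<in> verts H" using f'(1)[OF u(1)] V y by auto
      then show "w \<in> C y"
        using component_at_step[of u H v w] f'[OF u(1)] u by (auto simp: C_def K_def)
    qed
    \<comment> \<open>Vertices with a common image are both neighbours of it in column
      \<open>x\<close>, where the degree condition for \<open>- e\<close> allows only one.\<close>
    moreover have "inj_on f (C x)"
    proof (rule inj_onI)
      fix u u' assume u: "u \<in> C x" "u' \<in> C x" "f u = f u'"
      have "f u \<in> verts H" using f'(1)[OF u(1)] V y by auto
      then have "card (nbrs_in_column n (edges H) (f u) x) = 1"
        using deg[of "f u" x "- e"] x e yx f'(1)[OF u(1)] by auto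
      moreover have "u \<in> nbrs_in_column n (edges H) (f u) x"
        "u' \<in> nbrs_in_column n (edges H) (f u) x"
        using f'(2)[OF u(1)] f'(2)[OF u(2)] u KV
        by (auto simp: nbrs_in_column_def C_def insert_commute mem_Times_iff)
      ultimately show "u = u'" by (auto simp: card_1_singleton_iff)
    qed
    ultimately show ?thesis by (intro card_inj_on_le[of f]) (auto simp: finC)
  qed
  have "card (C (int i)) = card (C 0)" if "i < m" for i
    using that
  proof (induction i)
    case (Suc i)
    have "card (C (int i)) \<le> card (C (int (Suc i)))"
      by (rule le[where e = 1]) (use Suc.prems in \<open>auto simp: add.commute\<close>)
    moreover have "card (C (int (Suc i))) \<le> card (C (int i))"
      by (rule le[where e = "-1"]) (use Suc.prems in auto)
    ultimately show ?case using Suc by simp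
  qed simp
  then have const: "card (C x) = card (C 0)" if "x \<in> {0..<int m}" for x
    using that by (metis atLeastLessThan_iff nat_less_iff int_nat_eq)
  have "K = (\<Union>x\<in>{0..<int m}. C x)" using KV by (auto simp: C_def)
  then have "card K = card (\<Union>x\<in>{0..<int m}. C x)" by simp
  also have "\<dots> = (\<Sum>x\<in>{0..<int m}. card (C x))"
    by (rule card_UN_disjoint) (auto simp: finC, auto simp: C_def)
  also have "\<dots> = (\<Sum>x\<in>{0..<int m}. card (C 0))" by (rule sum.cong[OF refl const])
  also have "\<dots> = m * card (C 0)" by simp
  finally show ?thesis by (simp add: K_def)
qed

theorem theorem3p3:
  fixes m n :: nat
  assumes "m \<ge> 3" and "odd m" and "n \<ge> 3" and "\<not> m dvd n"
  shows "(n - 1, 1) \<notin> HWP (cycle_blowup m n) m n"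
proof
  let ?G = "cycle_blowup m n"
  assume "(n - 1, 1) \<in> HWP ?G m n"
  then obtain As Bs where lens: "length As = n - 1" "length Bs = 1"
    and As: "\<And>H. H \<in> set As \<Longrightarrow> cycle_factor m ?G H"
    and Bs: "\<And>H. H \<in> set Bs \<Longrightarrow> cycle_factor n ?G H"
    and dist: "distinct (map edges (As @ Bs))"
    and part: "partition_on (edges ?G) (set (map edges (As @ Bs)))"
    unfolding HWP_def by auto
  obtain H where H: "Bs = [H]" using lens(2) by (auto simp: length_Suc_conv)
  have facH: "cycle_factor n ?G H" using Bs H by simp
  then have spanH: "spanning_subgraph H ?G" by (simp add: cycle_factor_def)
  then have V: "verts H = verts ?G" by (simp add: spanning_subgraph_def)
  \<comment> \<open>Of the \<open>n\<close> edges from \<open>v\<close> to column \<open>y\<close>,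
    each of the \<open>n - 1\<close> factors into \<open>m\<close>-cycles takes one, so one remains
    for \<open>H\<close>.\<close>
  have deg: "card (nbrs_in_column n (edges H) v y) = 1"
    if v: "v \<in> verts H" and y: "y \<in> {0..<int m}" and e: "e \<in> {1, -1}"
      and ye: "[y = fst v + e] (mod int m)" for v y e
  proof -
    let ?d = "\<lambda>E. card (nbrs_in_column n E v y)"
    have v': "v \<in> verts ?G" using v V by simp
    have "n = sum ?d (set (map edges (As @ Bs)))"
      using sum_column_degrees[OF part _ v' y e ye] by simp
    \<comment> \<open>Distinctness lets the sum over the set of parts be taken over the list, where
      the factors can be counted.\<close>
    also have "\<dots> = (\<Sum>E\<leftarrow>map edges (As @ Bs). ?d E)"
      using dist by (rule sum_list_distinct_conv_sum_set[symmetric])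
    also have "\<dots> = (\<Sum>A\<leftarrow>As. ?d (edges A)) + ?d (edges H)"
      by (simp add: H o_def)
    also have "(\<Sum>A\<leftarrow>As. ?d (edges A)) = (\<Sum>A\<leftarrow>As. 1)"
      using m_factor_column_degree[OF \<open>odd m\<close> As v' y e ye]
      by (intro arg_cong[where f = sum_list] map_cong) auto
    also have "\<dots> = n - 1" using lens(1) by (simp add: sum_list_triv)
    finally show ?thesis using \<open>n \<ge> 3\<close> by simp
  qed
  have v0: "(0, 0) \<in> verts ?G" using assms by (simp add: verts_blowup)
  obtain vs where "distinct vs" "length vs = n" "component_at H (0, 0) = set vs"
    using cycle_factor_component[OF facH v0] by metis
  \<comment> \<open>The component is an \<open>n\<close>-cycle, yet its size is a multiple of
    \<open>m\<close>.\<close>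
  then have "card (component_at H (0, 0)) = n" by (simp add: distinct_card)
  moreover have "m dvd card (component_at H (0, 0))"
    by (rule dvd_card_component[OF spanH deg]) (use v0 V in auto)
  ultimately show False using \<open>\<not> m dvd n\<close> by simp
qed

end
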